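(* Let $\mathcal{T}$ be the binary tetrahedral group. Then $\mu(\mathcal{T}\circ\mathcal{T})=24$.
   Context: For a finite group $G$, $\mu(G)$ denotes the minimal faithful permutation degree of $G$: the least non-negative integer $m$ such that $G$ embeds in $\mathrm{Sym}(m)$. In the real quaternions $\mathbb{H}$, let $Q_8=\{\pm1,\pm i,\pm j,\pm k\}$ and $\omega=\frac12(-1+i+j+k)$. The binary tetrahedral group is $\mathcal{T}=Q_8\langle\omega\rangle\cong Q_8\rtimes C_3$, of order $24$, with centre $\{\pm1\}$. The central product of a group $G$ with itself is $G\circ G=(G\times G)/\{(z,z): z\in Z(G)\}$; here $\mathcal{T}\circ\mathcal{T}=(\mathcal{T}\times\mathcal{T})/\langle(-1,-1)\rangle$. *)

theory Defs
  imports Complex_Main "HOL-Algebra.Sym_Groups"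
begin

section \<open>The real quaternions\<close>

datatype quat = Quat (qRe: real) (qIm1: real) (qIm2: real) (qIm3: real)

lemma quat_eq_iff:
  "p = q \<longleftrightarrow> qRe p = qRe q \<and> qIm1 p = qIm1 q \<and> qIm2 p = qIm2 q \<and> qIm3 p = qIm3 q"
  by (cases p; cases q) simp

instantiation quat :: real_algebra_1
begin

definition zero_quat :: quat where "0 = Quat 0 0 0 0"

definition one_quat :: quat where "1 = Quat 1 0 0 0"

definition plus_quat :: "quat \<Rightarrow> quat \<Rightarrow> quat" where
  "p + q = Quat (qRe p + qRe q) (qIm1 p + qIm1 q) (qIm2 p + qIm2 q) (qIm3 p + qIm3 q)"

definition uminus_quat :: "quat \<Rightarrow> quat" where
  "- p = Quat (- qRe p) (- qIm1 p) (- qIm2 p) (- qIm3 p)"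

definition minus_quat :: "quat \<Rightarrow> quat \<Rightarrow> quat" where
  "p - q = Quat (qRe p - qRe q) (qIm1 p - qIm1 q) (qIm2 p - qIm2 q) (qIm3 p - qIm3 q)"

definition scaleR_quat :: "real \<Rightarrow> quat \<Rightarrow> quat" where
  "scaleR r p = Quat (r * qRe p) (r * qIm1 p) (r * qIm2 p) (r * qIm3 p)"

definition times_quat :: "quat \<Rightarrow> quat \<Rightarrow> quat" where
  "p * q = Quat
    (qRe p * qRe q - qIm1 p * qIm1 q - qIm2 p * qIm2 q - qIm3 p * qIm3 q)
    (qRe p * qIm1 q + qIm1 p * qRe q + qIm2 p * qIm3 q - qIm3 p * qIm2 q)
    (qRe p * qIm2 q - qIm1 p * qIm3 q + qIm2 p * qRe q + qIm3 p * qIm1 q)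
    (qRe p * qIm3 q + qIm1 p * qIm2 q - qIm2 p * qIm1 q + qIm3 p * qRe q)"

instance
  by standard
    (simp_all add: quat_eq_iff zero_quat_def one_quat_def plus_quat_def uminus_quat_def
      minus_quat_def scaleR_quat_def times_quat_def algebra_simps)

end

definition quat_i :: quat where "quat_i = Quat 0 1 0 0"

definition quat_j :: quat where "quat_j = Quat 0 0 1 0"

definition quat_k :: quat where "quat_k = Quat 0 0 0 1"

lemma quat_relations:
  "quat_i * quat_i = - 1" "quat_j * quat_j = - 1" "quat_k * quat_k = - 1"
  "quat_i * quat_j = quat_k" "quat_j * quat_k = quat_i" "quat_k * quat_i = quat_j"
  by (simp_all add: quat_i_def quat_j_def quat_k_def times_quat_def one_quat_def uminus_quat_def)


section \<open>The binary tetrahedral group\<close>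

definition quat_units :: "quat monoid" where
  "quat_units = units_of \<lparr>carrier = UNIV, mult = (*), one = 1\<rparr>"

definition Q8 :: "quat set" where
  "Q8 = {1, - 1, quat_i, - quat_i, quat_j, - quat_j, quat_k, - quat_k}"

definition quat_omega :: quat where
  "quat_omega = (1 / 2) *\<^sub>R (- 1 + quat_i + quat_j + quat_k)"

definition binary_tetrahedral :: "quat monoid" where
  "binary_tetrahedral =
    quat_units\<lparr>carrier := Q8 <#>\<^bsub>quat_units\<^esub> generate quat_units {quat_omega}\<rparr>"


section \<open>Central product of a group with itself\<close>

definition group_center :: "('a, 'b) monoid_scheme \<Rightarrow> 'a set" where
  "group_center G = {z \<in> carrier G. \<forall>g \<in> carrier G. z \<otimes>\<^bsub>G\<^esub> g = g \<otimes>\<^bsub>G\<^esub> z}"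

text \<open>
  The subgroup factored out is the diagonal \<open>{(z, z)}\<close>, not the antidiagonal
  \<open>{(z, z\<inverse>)}\<close>; the two agree when the centre has exponent at most 2.
\<close>

definition central_square :: "('a, 'b) monoid_scheme \<Rightarrow> ('a \<times> 'a) set monoid" where
  "central_square G = (G \<times>\<times> G) Mod {(z, z) | z. z \<in> group_center G}"


section \<open>Minimal faithful permutation degree\<close>

text \<open>Meaningful for finite groups, where the set of degrees is nonempty by Cayley's theorem.\<close>

definition min_perm_degree :: "('a, 'b) monoid_scheme \<Rightarrow> nat" where
  "min_perm_degree G = (LEAST m. mon G (sym_group m) \<noteq> {})"

end

theory Submission
  imports Defs "HOL-Algebra.Zassenhaus"
begin

text \<open>
  Write \<open>T\<close> for the binary tetrahedral group. It has order 24, and \<open>Q8\<close> is a normal subgroup of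
  index 3.

  Upper bound: for every finite group \<open>G\<close>, the product \<open>G \<times> G\<close> acts on the set \<open>G\<close> by
  \<open>(a, b) \<cdot> x = a x b\<^sup>-\<^sup>1\<close>. An element acting trivially satisfies \<open>a = b\<close> (take \<open>x = 1\<close>), and then
  commutes with every \<open>x\<close>; so the kernel is exactly the diagonal copy of the centre, and the
  central square of \<open>G\<close> acts faithfully on \<open>|G|\<close> points (lemma \<open>central_square_embeds\<close>).

  Lower bound: in a faithful action of the central square of \<open>T\<close> on \<open>m\<close> points, the class of
  \<open>(-1, 1)\<close> moves some point. Pull the stabilizer of that point back to a subgroup \<open>K\<close> of
  \<open>T \<times> T\<close>. It contains neither \<open>(-1, 1)\<close> nor \<open>(1, -1)\<close>, since these two act equally. Counting the
  orbit gives \<open>|T|\<^sup>2 \<le> |K| m\<close>, so it suffices that \<open>|K| \<le> |T|\<close>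
  (lemma \<open>card_subgroup_square_le\<close>). Let \<open>A\<close> and \<open>B\<close> be the intersections of \<open>K\<close> with the two
  factors. Every element of \<open>Q8\<close> other than \<open>1\<close> and \<open>-1\<close> squares to \<open>-1\<close>, so \<open>A\<close> and \<open>B\<close> meet \<open>Q8\<close>
  trivially and have at most 3 elements. If \<open>A\<close> is trivial, the second projection is injective on
  \<open>K\<close>, and \<open>|K| \<le> |T|\<close>. Otherwise choose \<open>a \<noteq> 1\<close> in \<open>A\<close>. The first projection \<open>P\<close> of \<open>K\<close> normalizes \<open>A\<close>,
  so for \<open>q \<in> P \<inter> Q8\<close> the commutator of \<open>q\<close> and \<open>a\<close> lies in \<open>A \<inter> Q8\<close> and is trivial; only \<open>1\<close> and
  \<open>-1\<close> in \<open>Q8\<close> commute with an element outside \<open>Q8\<close>. Hence \<open>|P| \<le> 3 \<cdot> 2\<close> and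
  \<open>|K| = |P| |B| \<le> 6 \<cdot> 3 < 24\<close>.
\<close>

section \<open>Counting in finite groups\<close>

text \<open>
  One estimate behind every count below: translating a nonempty fibre of \<open>f\<close> by the inverse of one of
  its points embeds it in \<open>N\<close>. Since \<open>S\<close> and \<open>N\<close> are arbitrary subsets, it serves for cosets, for
  orbits and for projections of subgroups of a product alike.
\<close>

lemma (in group) card_le_card_times_card_image:
  assumes S: "S \<subseteq> carrier G" "finite S" and "finite N"
    and fibre: "\<And>x y. x \<in> S \<Longrightarrow> y \<in> S \<Longrightarrow> f x = f y \<Longrightarrow> inv x \<otimes> y \<in> N"
  shows "card S \<le> card N * card (f ` S)"
proof -
  have "card {y \<in> S. f y = v} \<le> card N" if v: "v \<in> f ` S" for v
  proof -
    obtain x where x: "x \<in> S" "f x = v" using v by auto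
    show ?thesis
    proof (rule card_inj_on_le[where f = "\<lambda>y. inv x \<otimes> y"])
      show "inj_on (\<lambda>y. inv x \<otimes> y) {y \<in> S. f y = v}"
        using S x by (auto simp: inj_on_def subset_iff)
      show "(\<lambda>y. inv x \<otimes> y) ` {y \<in> S. f y = v} \<subseteq> N"
        using fibre x by auto
    qed (fact \<open>finite N\<close>)
  qed
  moreover have "card S \<le> (\<Sum>v\<in>f ` S. card {y \<in> S. f y = v})"
  proof -
    have "S = (\<Union>v\<in>f ` S. {y \<in> S. f y = v})" by auto
    then show ?thesis using card_UN_le[of "f ` S" "\<lambda>v. {y \<in> S. f y = v}"] S by simp
  qed
  ultimately show ?thesis
    using sum_bounded_above[of "f ` S" "\<lambda>v. card {y \<in> S. f y = v}" "card N"]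
    by (simp add: mult.commute)
qed

lemma (in group) card_subgroup_le_index:
  assumes fin: "finite (carrier G)" and N: "N \<lhd> G" and H: "subgroup H G"
  shows "card H \<le> card (H \<inter> N) * card (rcosets N)"
proof -
  interpret N: normal N G by fact
  have sub: "H \<subseteq> carrier G" using H by (rule subgroup.subset)
  have "card H \<le> card (H \<inter> N) * card ((\<lambda>x. N #> x) ` H)"
  proof (rule card_le_card_times_card_image)
    fix x y assume xy: "x \<in> H" "y \<in> H" "N #> x = N #> y"
    then have c: "x \<in> carrier G" "y \<in> carrier G" using sub by auto
    have "x <# N = y <# N" using xy c N.coset_eq by simp
    moreover have "y \<in> y <# N" using c N.one_closed by (force simp: l_coset_def)
    ultimately have "y \<in> x <# N" by simp
    then obtain n where "n \<in> N" "y = x \<otimes> n" by (auto simp: l_coset_def)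
    then have "inv x \<otimes> y \<in> N" using c by (simp flip: m_assoc)
    then show "inv x \<otimes> y \<in> H \<inter> N"
      using xy H by (simp add: subgroup.m_closed subgroup.m_inv_closed)
  qed (use sub finite_subset[OF sub fin] in simp_all)
  also have "\<dots> \<le> card (H \<inter> N) * card (rcosets N)"
  proof (rule mult_le_mono[OF order_refl card_mono])
    show "finite (rcosets N)" using fin by (simp add: RCOSETS_def)
    show "(\<lambda>x. N #> x) ` H \<subseteq> rcosets N" using sub by (auto simp: RCOSETS_def)
  qed
  finally show ?thesis .
qed

section \<open>Subgroups of a square avoiding a pair of central elements\<close>

text \<open>
  The hypotheses \<open>square\<close> and \<open>centralizer\<close> are what \<open>Q8\<close>, with \<open>z = - 1\<close>, contributes.
  The first forces a subgroup of \<open>G\<close> without \<open>z\<close> to meet \<open>N\<close> trivially; the second forces an element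
  of \<open>N\<close> that normalizes a nontrivial such subgroup to be \<open>\<one>\<close> or \<open>z\<close>. The bound \<open>18 = (3 \<cdot> 2) \<cdot> 3\<close>
  covers a nontrivial intersection of \<open>K\<close> with the first factor, and \<open>order G\<close> a trivial one.
\<close>

lemma (in group) card_subgroup_square_le:
  assumes fin: "finite (carrier G)"
    and N: "N \<lhd> G" and index: "card (rcosets N) = 3"
    and square: "\<And>q. q \<in> N \<Longrightarrow> q \<noteq> \<one> \<Longrightarrow> q \<noteq> z \<Longrightarrow> q \<otimes> q = z"
    and centralizer: "\<And>q a. q \<in> N \<Longrightarrow> a \<in> carrier G - N \<Longrightarrow> q \<otimes> a = a \<otimes> q \<Longrightarrow> q = \<one> \<or> q = z"
    and K: "subgroup K (G \<times>\<times> G)" and zK: "(z, \<one>) \<notin> K" "(\<one>, z) \<notin> K"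
  shows "card K \<le> max (order G) 18"
proof -
  interpret GG: group "G \<times>\<times> G" by (intro DirProd_group is_group)
  interpret K: subgroup K "G \<times>\<times> G" by fact
  interpret N: normal N G by fact
  have K_carrier: "x \<in> carrier G" "y \<in> carrier G" if "(x, y) \<in> K" for x y
    using K.subset that by auto
  have K_mult: "(x \<otimes> x', y \<otimes> y') \<in> K" if "(x, y) \<in> K" "(x', y') \<in> K" for x y x' y'
    using K.m_closed[OF that] by simp
  have K_inv: "(inv x, inv y) \<in> K" if "(x, y) \<in> K" for x y
    using K.m_inv_closed[OF that] K_carrier[OF that] is_group by simp
  have K_one: "(\<one>, \<one>) \<in> K" using K.one_closed by simp
  have finK: "finite K"
    using finite_subset[OF K.subset] fin by simp
  \<comment> \<open>The intersections of \<open>K\<close> with the two factors, as in Goursat's lemma\<close>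
  define A where "A = {x. (x, \<one>) \<in> K}"
  define B where "B = {y. (\<one>, y) \<in> K}"
  have A: "subgroup A G"
    using K_carrier K_one K_mult[of _ \<one> _ \<one>] K_inv[of _ \<one>]
    by (intro subgroupI) (auto simp: A_def)
  have B: "subgroup B G"
    using K_carrier K_one K_mult[of \<one> _ \<one>] K_inv[of \<one>]
    by (intro subgroupI) (auto simp: B_def)
  have fst_K: "subgroup (fst ` K) G"
  proof (rule subgroupI)
    fix a assume "a \<in> fst ` K"
    then show "inv a \<in> fst ` K" using K_inv by force
  next
    fix a b assume "a \<in> fst ` K" "b \<in> fst ` K"
    then obtain y y' where "(a, y) \<in> K" "(b, y') \<in> K" by auto
    then show "a \<otimes> b \<in> fst ` K" using K_mult by force
  qed (use K_carrier K_one in auto)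
  have avoids: "H \<inter> N \<subseteq> {\<one>}" if H: "subgroup H G" and "z \<notin> H" for H
  proof
    fix q assume q: "q \<in> H \<inter> N"
    then have "q \<otimes> q \<in> H" using H by (simp add: subgroup.m_closed)
    then show "q \<in> {\<one>}" using square[of q] q \<open>z \<notin> H\<close> by auto
  qed
  have AN: "A \<inter> N \<subseteq> {\<one>}" and BN: "B \<inter> N \<subseteq> {\<one>}"
    using avoids[OF A] avoids[OF B] zK by (auto simp: A_def B_def)
  show ?thesis
  proof (cases "A \<subseteq> {\<one>}")
    case True
    have "card K \<le> card {(\<one>, \<one>)} * card (snd ` K)"
    proof (rule GG.card_le_card_times_card_image)
      fix p q assume pq: "p \<in> K" "q \<in> K" "snd p = snd q"
      obtain x x' y where eq: "p = (x, y)" "q = (x', y)" using pq by (cases p; cases q) auto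
      then have c: "x \<in> carrier G" "x' \<in> carrier G" "y \<in> carrier G"
        using pq K_carrier by auto
      have "(inv x \<otimes> x', inv y \<otimes> y) \<in> K" using K_mult K_inv pq eq by auto
      then have "inv x \<otimes> x' \<in> A" using c by (simp add: A_def)
      then show "inv\<^bsub>G \<times>\<times> G\<^esub> p \<otimes>\<^bsub>G \<times>\<times> G\<^esub> q \<in> {(\<one>, \<one>)}"
        using True eq c is_group by auto
    qed (use K.subset finK in auto)
    also have "\<dots> \<le> order G"
      using K_carrier fin by (auto simp: order_def intro!: card_mono)
    finally show ?thesis by simp
  next
    case False
    then obtain a where a: "a \<in> A" "a \<noteq> \<one>" by auto
    have "a \<in> carrier G" using A a subgroup.subset by blast
    have "a \<notin> N" using a AN by auto
    have "fst ` K \<inter> N \<subseteq> {\<one>, z}"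
    proof
      fix q assume "q \<in> fst ` K \<inter> N"
      then obtain y where y: "(q, y) \<in> K" and qN: "q \<in> N" by auto
      have c: "q \<in> carrier G" "y \<in> carrier G" using K_carrier y by auto
      \<comment> \<open>The commutator of \<open>q\<close> and \<open>a\<close> lies in \<open>A\<close>, which \<open>q\<close> normalizes, and in the normal subgroup \<open>N\<close>.\<close>
      have "(q \<otimes> a \<otimes> inv q, y \<otimes> \<one> \<otimes> inv y) \<in> K"
        using a y by (intro K_mult K_inv) (auto simp: A_def)
      then have "q \<otimes> a \<otimes> inv q \<in> A" using c by (simp add: A_def)
      then have "q \<otimes> a \<otimes> inv q \<otimes> inv a \<in> A"
        using A a by (simp add: subgroup.m_closed subgroup.m_inv_closed)
      moreover have "a \<otimes> inv q \<otimes> inv a \<in> N"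
        using N.inv_op_closed2 qN \<open>a \<in> carrier G\<close> by simp
      then have "q \<otimes> (a \<otimes> inv q \<otimes> inv a) \<in> N" using qN by simp
      then have "q \<otimes> a \<otimes> inv q \<otimes> inv a \<in> N" using c \<open>a \<in> carrier G\<close> by (simp add: m_assoc)
      ultimately have "q \<otimes> a \<otimes> inv q \<otimes> inv a = \<one>" using AN by auto
      then have "q \<otimes> a \<otimes> inv (a \<otimes> q) = \<one>"
        using c \<open>a \<in> carrier G\<close> by (simp add: m_assoc inv_mult_group)
      then have "q \<otimes> a = a \<otimes> q" using c \<open>a \<in> carrier G\<close>
        by (metis inv_equality inv_inv inv_closed m_closed)
      then show "q \<in> {\<one>, z}" using centralizer[of q a] qN \<open>a \<notin> N\<close> \<open>a \<in> carrier G\<close> by auto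
    qed
    then have "card (fst ` K \<inter> N) \<le> card {\<one>, z}" by (intro card_mono) auto
    also have "\<dots> \<le> 2" by (cases "z = \<one>") auto
    finally have fst: "card (fst ` K) \<le> 6"
      using card_subgroup_le_index[OF fin N fst_K] index by simp
    have "card (B \<inter> N) \<le> 1" using card_mono[OF _ BN] by simp
    then have "card B \<le> 3" using card_subgroup_le_index[OF fin N B] index by simp
    have "card K \<le> card ({\<one>} \<times> B) * card (fst ` K)"
    proof (rule GG.card_le_card_times_card_image)
      fix p q assume pq: "p \<in> K" "q \<in> K" "fst p = fst q"
      obtain x y y' where eq: "p = (x, y)" "q = (x, y')" using pq by (cases p; cases q) auto
      then have c: "x \<in> carrier G" "y \<in> carrier G" "y' \<in> carrier G"
        using pq K_carrier by auto
      have "(inv x \<otimes> x, inv y \<otimes> y') \<in> K" using K_mult K_inv pq eq by auto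
      then show "inv\<^bsub>G \<times>\<times> G\<^esub> p \<otimes>\<^bsub>G \<times>\<times> G\<^esub> q \<in> {\<one>} \<times> B"
        using eq c is_group by (auto simp: B_def)
    next
      show "finite ({\<one>} \<times> B)" using finite_subset[OF subgroup.subset[OF B] fin] by simp
    qed (use K.subset finK in auto)
    also have "\<dots> \<le> 3 * 6"
      using fst \<open>card B \<le> 3\<close> by (intro mult_le_mono) (simp_all add: card_cartesian_product_singleton)
    finally show ?thesis by simp
  qed
qed

section \<open>Actions by homomorphisms into a symmetric group\<close>

lemma (in group) subgroup_stabilizer_hom:
  assumes f: "f \<in> hom G (sym_group m)"
  shows "subgroup {g \<in> carrier G. f g p = p} G"
proof (rule subgroupI)
  interpret f: group_hom G "sym_group m" f
    by (intro group_hom.intro group_hom_axioms.intro is_group sym_group_is_group f)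
  show "{g \<in> carrier G. f g p = p} \<noteq> {}"
    using f.hom_one by (auto simp: sym_group_one intro!: exI[of _ \<one>])
  fix a assume a: "a \<in> {g \<in> carrier G. f g p = p}"
  then have "f (inv a \<otimes> a) p = f (inv a) (f a p)"
    using f.hom_mult[of "inv a" a] by (simp add: sym_group_mult)
  then have "f (inv a) p = p" using a by (simp add: sym_group_one)
  then show "inv a \<in> {g \<in> carrier G. f g p = p}" using a by simp
  fix b assume b: "b \<in> {g \<in> carrier G. f g p = p}"
  then show "a \<otimes> b \<in> {g \<in> carrier G. f g p = p}"
    using a f.hom_mult[of a b] by (simp add: sym_group_mult)
qed auto

text \<open>
  The orbit of \<open>p\<close> has at most \<open>m\<close> points, and the group elements taking \<open>p\<close> to a given point form
  a left coset of the stabilizer.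
\<close>

lemma (in group) order_le_card_stabilizer_times_degree:
  assumes fin: "finite (carrier G)" and f: "f \<in> hom G (sym_group m)" and p: "p \<in> {1..m}"
  shows "order G \<le> card {g \<in> carrier G. f g p = p} * m"
proof -
  interpret f: group_hom G "sym_group m" f
    by (intro group_hom.intro group_hom_axioms.intro is_group sym_group_is_group f)
  let ?K = "{g \<in> carrier G. f g p = p}"
  have "order G \<le> card ?K * card ((\<lambda>g. f g p) ` carrier G)"
    unfolding order_def
  proof (rule card_le_card_times_card_image)
    fix x y assume xy: "x \<in> carrier G" "y \<in> carrier G" "f x p = f y p"
    then have "f (inv x \<otimes> y) p = f (inv x) (f x p)"
      using f.hom_mult[of "inv x" y] by (simp add: sym_group_mult)
    also have "\<dots> = f (inv x \<otimes> x) p"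
      using xy(1) f.hom_mult[of "inv x" x] by (simp add: sym_group_mult del: l_inv)
    finally show "inv x \<otimes> y \<in> ?K" using xy by (simp add: sym_group_one)
  qed (use fin in auto)
  also have "card ((\<lambda>g. f g p) ` carrier G) \<le> m"
  proof -
    have "f g p \<in> {1..m}" if "g \<in> carrier G" for g
      using f.hom_closed[OF that] p permutes_in_image[of "f g" "{1..m}"]
      by (simp add: sym_group_carrier)
    then have "card ((\<lambda>g. f g p) ` carrier G) \<le> card {1..m}"
      by (intro card_mono) auto
    then show ?thesis by simp
  qed
  finally show ?thesis by simp
qed

section \<open>Permutation representations of a central square\<close>

abbreviation diagonal_center :: "('a, 'b) monoid_scheme \<Rightarrow> ('a \<times> 'a) set" where
  "diagonal_center G \<equiv> {(z, z) | z. z \<in> group_center G}"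

text \<open>
  The action \<open>(a, b) \<cdot> x = a x b\<^sup>-\<^sup>1\<close> of \<open>G \<times> G\<close> on \<open>G\<close>, carried over to \<open>{1..order G}\<close> by a
  numbering of the elements.
\<close>

lemma (in group) translation_action:
  assumes fin: "finite (carrier G)"
  obtains h where "group_hom (G \<times>\<times> G) (sym_group (order G)) h"
    and "kernel (G \<times>\<times> G) (sym_group (order G)) h = diagonal_center G"
proof -
  interpret GG: group "G \<times>\<times> G" by (intro DirProd_group is_group)
  let ?I = "{1..order G}"
  obtain e where e: "bij_betw e ?I (carrier G)"
    using finite_same_card_bij[of ?I "carrier G"] fin by (auto simp: order_def)
  define d where "d = inv_into ?I e"
  have d: "bij_betw d (carrier G) ?I"
    unfolding d_def using e by (rule bij_betw_inv_into)
  have e_in: "e k \<in> carrier G" if "k \<in> ?I" for k using e that by (rule bij_betw_apply)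
  have d_in: "d x \<in> ?I" if "x \<in> carrier G" for x using d that by (rule bij_betw_apply)
  have ed: "e (d x) = x" if "x \<in> carrier G" for x
    unfolding d_def using e that by (rule bij_betw_inv_into_right)
  have de: "d (e k) = k" if "k \<in> ?I" for k
    unfolding d_def using e that by (rule bij_betw_inv_into_left)
  define h where "h = (\<lambda>(a, b) k. if k \<in> ?I then d (a \<otimes> e k \<otimes> inv b) else k)"
  have h_in: "h (a, b) k \<in> ?I" if "a \<in> carrier G" "b \<in> carrier G" "k \<in> ?I" for a b k
    using that d_in e_in by (simp add: h_def del: atLeastAtMost_iff)
  have h_mult: "h (a \<otimes> a', b \<otimes> b') k = h (a, b) (h (a', b') k)"
    if "a \<in> carrier G" "b \<in> carrier G" "a' \<in> carrier G" "b' \<in> carrier G" for a b a' b' k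
  proof (cases "k \<in> ?I")
    case True
    then have "e (h (a', b') k) = a' \<otimes> e k \<otimes> inv b'"
      using that e_in by (simp add: h_def ed del: atLeastAtMost_iff)
    then show ?thesis
      using True that h_in[of a' b' k] e_in[OF True]
      by (simp add: h_def m_assoc inv_mult_group del: atLeastAtMost_iff)
  qed (auto simp: h_def)
  have h_one: "h (\<one>, \<one>) k = k" for k
    using e_in de by (simp add: h_def del: atLeastAtMost_iff)
  have h_perm: "h (a, b) permutes ?I" if "a \<in> carrier G" "b \<in> carrier G" for a b
  proof (rule bij_imp_permutes)
    show "bij_betw (h (a, b)) ?I ?I"
      using that h_in h_mult[of a b "inv a" "inv b"] h_mult[of "inv a" "inv b" a b] h_one
      by (intro bij_betw_byWitness[where f' = "h (inv a, inv b)"])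
        (auto simp del: atLeastAtMost_iff)
  qed (simp add: h_def del: atLeastAtMost_iff)
  have "h \<in> hom (G \<times>\<times> G) (sym_group (order G))"
    using h_perm h_mult by (auto simp: hom_def sym_group_carrier sym_group_mult)
  then have "group_hom (G \<times>\<times> G) (sym_group (order G)) h"
    by (intro group_hom.intro group_hom_axioms.intro GG.is_group sym_group_is_group)
  moreover have "kernel (G \<times>\<times> G) (sym_group (order G)) h = diagonal_center G"
  proof (intro equalityI subsetI)
    fix p assume "p \<in> kernel (G \<times>\<times> G) (sym_group (order G)) h"
    then obtain a b where p: "p = (a, b)" "a \<in> carrier G" "b \<in> carrier G" "h (a, b) = id"
      by (cases p) (auto simp: kernel_def sym_group_one)
    have fix_all: "a \<otimes> x \<otimes> inv b = x" if "x \<in> carrier G" for x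
    proof -
      have "d (a \<otimes> x \<otimes> inv b) = d x"
        using p(4) that d_in ed by (simp add: h_def fun_eq_iff del: atLeastAtMost_iff) metis
      then show ?thesis using ed that p by (metis inv_closed m_closed)
    qed
    have eq: "a \<otimes> x = x \<otimes> b" if "x \<in> carrier G" for x
      using fix_all[OF that] that p by (metis inv_closed inv_solve_right' m_closed)
    have "a = b" using eq[of \<one>] p by simp
    then show "p \<in> diagonal_center G" using p eq by (auto simp: group_center_def)
  next
    fix p assume "p \<in> diagonal_center G"
    then obtain z where z: "p = (z, z)" "z \<in> carrier G"
      "\<And>g. g \<in> carrier G \<Longrightarrow> z \<otimes> g = g \<otimes> z" by (auto simp: group_center_def)
    have "z \<otimes> x \<otimes> inv z = x" if "x \<in> carrier G" for x
      using that z by (simp add: m_assoc)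
    then have "h (z, z) k = k" for k
      using e_in de by (simp add: h_def del: atLeastAtMost_iff)
    then have "h (z, z) = id" by (simp add: fun_eq_iff)
    then show "p \<in> kernel (G \<times>\<times> G) (sym_group (order G)) h"
      using z by (simp add: kernel_def sym_group_one)
  qed
  ultimately show thesis by (rule that)
qed

lemma (in group) diagonal_center_normal:
  assumes "finite (carrier G)"
  shows "diagonal_center G \<lhd> G \<times>\<times> G"
proof -
  obtain h where "group_hom (G \<times>\<times> G) (sym_group (order G)) h"
    and "kernel (G \<times>\<times> G) (sym_group (order G)) h = diagonal_center G"
    using translation_action[OF assms] .
  then show ?thesis using group_hom.normal_kernel by metis
qed

lemma (in group) central_square_embeds:
  assumes "finite (carrier G)"
  shows "mon (central_square G) (sym_group (order G)) \<noteq> {}"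
proof -
  obtain h where h: "group_hom (G \<times>\<times> G) (sym_group (order G)) h"
    and ker: "kernel (G \<times>\<times> G) (sym_group (order G)) h = diagonal_center G"
    using translation_action[OF assms] .
  interpret h: group_hom "G \<times>\<times> G" "sym_group (order G)" h by (fact h)
  have "(\<lambda>X. the_elem (h ` X)) \<in> mon (central_square G) (sym_group (order G))"
    using h.FactGroup_hom h.FactGroup_inj_on unfolding ker central_square_def mon_def by simp
  then show ?thesis by blast
qed

text \<open>
  Faithfulness makes \<open>(z, \<one>)\<close> move a point, whose stabilizer in \<open>G \<times> G\<close> is a subgroup to which
  \<open>bound\<close> applies: \<open>(\<one>, z)\<close> moves the point as well, because the product \<open>(z, z)\<close> of the two
  pairs acts trivially.
\<close>

lemma (in group) central_square_degree_ge:
  assumes fin: "finite (carrier G)"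
    and z: "z \<in> group_center G" "z \<noteq> \<one>"
    and bound: "\<And>K. subgroup K (G \<times>\<times> G) \<Longrightarrow> (z, \<one>) \<notin> K \<Longrightarrow> (\<one>, z) \<notin> K \<Longrightarrow> card K \<le> order G"
    and \<phi>: "\<phi> \<in> mon (central_square G) (sym_group m)"
  shows "order G \<le> m"
proof -
  interpret GG: group "G \<times>\<times> G" by (intro DirProd_group is_group)
  interpret D: normal "diagonal_center G" "G \<times>\<times> G" by (rule diagonal_center_normal[OF fin])
  let ?\<pi> = "\<lambda>g. diagonal_center G #>\<^bsub>G \<times>\<times> G\<^esub> g"
  define f where "f = \<phi> \<circ> ?\<pi>"
  have f: "f \<in> hom (G \<times>\<times> G) (sym_group m)"
    unfolding f_def
  proof (rule Group.hom_compose)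
    show "?\<pi> \<in> hom (G \<times>\<times> G) (central_square G)"
      unfolding central_square_def by (rule D.r_coset_hom_Mod)
  qed (use \<phi> in \<open>simp add: mon_def\<close>)
  interpret f: group_hom "G \<times>\<times> G" "sym_group m" f
    by (intro group_hom.intro group_hom_axioms.intro GG.is_group sym_group_is_group f)
  have f_one: "f (\<one>, \<one>) = id" using f.hom_one by (simp add: sym_group_one)
  have zc: "z \<in> carrier G" using z by (simp add: group_center_def)
  have f_eq: "f g = f g' \<longleftrightarrow> ?\<pi> g = ?\<pi> g'"
    if "g \<in> carrier (G \<times>\<times> G)" "g' \<in> carrier (G \<times>\<times> G)" for g g'
  proof -
    have "inj_on \<phi> (carrier (central_square G))" using \<phi> by (simp add: mon_def)
    then show ?thesis
      unfolding f_def comp_def central_square_def carrier_FactGroup using that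
      by (metis (no_types, lifting) imageI inj_onD)
  qed
  have pi_one: "?\<pi> (\<one>, \<one>) = diagonal_center G"
    using GG.coset_mult_one[OF D.subset] by simp
  have "?\<pi> (z, z) = diagonal_center G"
    using z zc by (intro GG.coset_join2 D.subgroup_axioms) auto
  then have f_zz: "f (z, z) = id" using f_eq[of "(z, z)" "(\<one>, \<one>)"] zc pi_one f_one by auto
  have "f (z, \<one>) \<noteq> id"
  proof
    assume "f (z, \<one>) = id"
    then have "?\<pi> (z, \<one>) = diagonal_center G"
      using f_eq[of "(z, \<one>)" "(\<one>, \<one>)"] zc pi_one f_one by auto
    then have "(z, \<one>) \<in> diagonal_center G"
      using GG.rcos_self[OF _ D.subgroup_axioms, of "(z, \<one>)"] zc by simp
    then show False using z by auto
  qed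
  then obtain p where p: "f (z, \<one>) p \<noteq> p" by (auto simp: fun_eq_iff)
  have "f (z, \<one>) permutes {1..m}"
    using f.hom_closed[of "(z, \<one>)"] zc by (simp add: sym_group_carrier)
  then have pm: "p \<in> {1..m}" using p by (meson permutes_not_in)
  let ?K = "{g \<in> carrier (G \<times>\<times> G). f g p = p}"
  have "f (\<one>, z) p \<noteq> p"
  proof
    assume "f (\<one>, z) p = p"
    moreover have "f (z, z) p = f (z, \<one>) (f (\<one>, z) p)"
      using f.hom_mult[of "(z, \<one>)" "(\<one>, z)"] zc by (simp add: sym_group_mult)
    ultimately show False using f_zz p by simp
  qed
  then have "card ?K \<le> order G"
    using p by (intro bound GG.subgroup_stabilizer_hom[OF f]) auto
  moreover have "order (G \<times>\<times> G) \<le> card ?K * m"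
    using fin pm by (intro GG.order_le_card_stabilizer_times_degree[OF _ f]) auto
  moreover have "order (G \<times>\<times> G) = order G * order G"
    by (simp add: order_def card_cartesian_product)
  ultimately have "order G * order G \<le> card ?K * m" by simp
  also have "\<dots> \<le> order G * m"
    using \<open>card ?K \<le> order G\<close> by (rule mult_le_mono1)
  finally show ?thesis using order_gt_0_iff_finite fin by simp
qed

section \<open>The binary tetrahedral group\<close>

lemmas quat_arith = quat_i_def quat_j_def quat_k_def quat_omega_def
  one_quat_def plus_quat_def uminus_quat_def scaleR_quat_def times_quat_def

lemma group_quat_units: "group quat_units"
  unfolding quat_units_def by (rule monoid.units_group) (standard, auto simp: mult.assoc)

lemma mult_quat_units [simp]: "x \<otimes>\<^bsub>quat_units\<^esub> y = x * y"
  by (simp add: quat_units_def units_of_def)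

lemma one_quat_units [simp]: "\<one>\<^bsub>quat_units\<^esub> = 1"
  by (simp add: quat_units_def units_of_def)

lemma quat_units_inverse:
  assumes "x * y = 1" "y * x = 1"
  shows "x \<in> carrier quat_units" "inv\<^bsub>quat_units\<^esub> x = y"
proof -
  have carrier: "u \<in> carrier quat_units" if "u * v = 1" "v * u = 1" for u v :: quat
    using that by (auto simp: quat_units_def units_of_def Units_def)
  show "x \<in> carrier quat_units" using assms carrier by blast
  show "inv\<^bsub>quat_units\<^esub> x = y"
    using assms carrier by (intro group.inv_equality group_quat_units) auto
qed

lemma Q8_closed: "x \<in> Q8 \<Longrightarrow> y \<in> Q8 \<Longrightarrow> x * y \<in> Q8"
  unfolding Q8_def by (elim insertE emptyE; simp add: quat_arith)

lemma subgroup_Q8: "subgroup Q8 quat_units"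
proof (rule group.subgroupI[OF group_quat_units])
  have inverse: "\<exists>y\<in>Q8. x * y = 1 \<and> y * x = 1" if "x \<in> Q8" for x
    using that unfolding Q8_def by (elim insertE emptyE; simp add: quat_arith)
  show "Q8 \<subseteq> carrier quat_units"
    using inverse quat_units_inverse(1) by blast
  show "inv\<^bsub>quat_units\<^esub> x \<in> Q8" if "x \<in> Q8" for x
    using inverse[OF that] quat_units_inverse(2) by auto
qed (auto simp: Q8_closed, auto simp: Q8_def)

lemma omega_cube: "quat_omega * (quat_omega * quat_omega) = 1"
  by (simp add: quat_arith)

lemma quat_omega_unit:
  "quat_omega \<in> carrier quat_units"
  "inv\<^bsub>quat_units\<^esub> quat_omega = quat_omega * quat_omega"
  using quat_units_inverse[OF omega_cube] omega_cube by (simp_all add: mult.assoc)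

definition omega_powers :: "quat set" where
  "omega_powers = {1, quat_omega, quat_omega * quat_omega}"

lemma generate_omega: "generate quat_units {quat_omega} = omega_powers"
proof
  interpret group quat_units by (rule group_quat_units)
  have square: "quat_omega * quat_omega \<in> carrier quat_units"
    "inv\<^bsub>quat_units\<^esub> (quat_omega * quat_omega) = quat_omega"
    using quat_units_inverse[OF _ omega_cube] omega_cube by (simp_all add: mult.assoc)
  have "1 \<in> carrier quat_units" "inv\<^bsub>quat_units\<^esub> 1 = 1"
    using quat_units_inverse[of 1 1] by auto
  then have "subgroup omega_powers quat_units"
    using quat_omega_unit square omega_cube
    by (intro subgroupI) (auto simp: omega_powers_def mult.assoc)
  then show "generate quat_units {quat_omega} \<subseteq> omega_powers"
    by (intro generate_subgroup_incl) (auto simp: omega_powers_def)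
  show "omega_powers \<subseteq> generate quat_units {quat_omega}"
    using generate.one[of quat_units "{quat_omega}"]
      generate.incl[of quat_omega "{quat_omega}" quat_units]
      generate.eng[of quat_omega quat_units "{quat_omega}" quat_omega]
    by (simp add: omega_powers_def)
qed

text \<open>
  Conjugation by \<open>\<omega>\<close> permutes \<open>i\<close>, \<open>j\<close>, \<open>k\<close> cyclically. Working in the normalizer of \<open>Q8\<close> among all
  quaternion units makes the product set \<open>Q8\<langle>\<omega>\<rangle>\<close> a subgroup with \<open>Q8\<close> normal in it.
\<close>

lemma omega_normalizes_Q8: "quat_omega \<in> normalizer quat_units Q8"
proof -
  have "(\<lambda>q. quat_omega * q * (quat_omega * quat_omega)) ` Q8 = Q8"
    by (simp add: Q8_def quat_arith insert_commute)
  moreover have "quat_omega <#\<^bsub>quat_units\<^esub> Q8 #>\<^bsub>quat_units\<^esub> inv\<^bsub>quat_units\<^esub> quat_omega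
      = (\<lambda>q. quat_omega * q * (quat_omega * quat_omega)) ` Q8"
    by (auto simp: l_coset_def r_coset_def quat_omega_unit)
  ultimately show ?thesis
    using quat_omega_unit subgroup.subset[OF subgroup_Q8]
    by (simp add: normalizer_def stabilizer_def)
qed

lemma carrier_binary_tetrahedral:
  "carrier binary_tetrahedral = {q * c | q c. q \<in> Q8 \<and> c \<in> omega_powers}"
  by (auto simp: binary_tetrahedral_def generate_omega set_mult_def)

lemma mult_binary_tetrahedral [simp]: "x \<otimes>\<^bsub>binary_tetrahedral\<^esub> y = x * y"
  and one_binary_tetrahedral [simp]: "\<one>\<^bsub>binary_tetrahedral\<^esub> = 1"
  by (simp_all add: binary_tetrahedral_def)

lemma group_binary_tetrahedral: "group binary_tetrahedral"
  and Q8_normal: "Q8 \<lhd> binary_tetrahedral"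
proof -
  interpret group quat_units by (rule group_quat_units)
  let ?N = "normalizer quat_units Q8"
  let ?T = "Q8 <#>\<^bsub>quat_units\<^esub> generate quat_units {quat_omega}"
  have N: "subgroup ?N quat_units"
    using subgroup.subset[OF subgroup_Q8] by (rule normalizer_imp_subgroup)
  have Q8_N: "Q8 \<lhd> quat_units\<lparr>carrier := ?N\<rparr>"
    using subgroup_Q8 by (rule subgroup_in_normalizer)
  have "generate quat_units {quat_omega} \<subseteq> ?N"
    using omega_normalizes_Q8 N by (intro generate_subgroup_incl) auto
  moreover have "subgroup (generate quat_units {quat_omega}) quat_units"
    using quat_omega_unit by (intro generate_is_subgroup) auto
  ultimately have "subgroup (generate quat_units {quat_omega}) (quat_units\<lparr>carrier := ?N\<rparr>)"
    using N by (intro subgroup_incl)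
  then have T_N: "subgroup ?T (quat_units\<lparr>carrier := ?N\<rparr>)"
    using mult_norm_sub_in_sub[OF Q8_N _ N] by simp
  then have T: "subgroup ?T quat_units" by (rule incl_subgroup[OF N])
  then show "group binary_tetrahedral"
    unfolding binary_tetrahedral_def by (rule subgroup_imp_group)
  interpret NG: group "quat_units\<lparr>carrier := ?N\<rparr>" using N by (rule subgroup_imp_group)
  have "Q8 \<subseteq> ?T"
    using generate.one[of quat_units "{quat_omega}"] by (force simp: set_mult_def)
  then show "Q8 \<lhd> binary_tetrahedral"
    using NG.normal_restrict_supergroup T_N Q8_N
    unfolding binary_tetrahedral_def by fastforce
qed

text \<open>
  The powers of \<open>\<omega>\<close> represent the cosets of \<open>Q8\<close>; they are inequivalent because \<open>\<omega>\<close> and \<open>\<omega>\<^sup>2\<close> have real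
  part \<open>-1/2\<close>, which no element of \<open>Q8\<close> has.
\<close>

lemma card_rcosets_Q8: "card (rcosets\<^bsub>binary_tetrahedral\<^esub> Q8) = 3"
proof -
  interpret T: group binary_tetrahedral by (rule group_binary_tetrahedral)
  interpret Q8: normal Q8 binary_tetrahedral by (rule Q8_normal)
  let ?r = "\<lambda>x. Q8 #>\<^bsub>binary_tetrahedral\<^esub> x"
  have sub: "omega_powers \<subseteq> carrier binary_tetrahedral"
    using Q8.one_closed by (force simp: carrier_binary_tetrahedral)
  have absorb: "?r (q * c) = ?r c" if q: "q \<in> Q8" and c: "c \<in> omega_powers" for q c
  proof -
    have carrier: "q \<in> carrier binary_tetrahedral" "c \<in> carrier binary_tetrahedral"
      using q c sub Q8.subset by blast+
    have "?r q = Q8" using carrier q by (intro T.coset_join2 Q8.subgroup_axioms)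
    then show ?thesis using T.coset_mult_assoc[OF Q8.subset carrier] by simp
  qed
  have "rcosets\<^bsub>binary_tetrahedral\<^esub> Q8 = ?r ` omega_powers"
  proof
    show "rcosets\<^bsub>binary_tetrahedral\<^esub> Q8 \<subseteq> ?r ` omega_powers"
    proof
      fix X assume "X \<in> rcosets\<^bsub>binary_tetrahedral\<^esub> Q8"
      then obtain x where "x \<in> carrier binary_tetrahedral" "X = ?r x"
        by (auto simp: RCOSETS_def)
      then obtain q c where "q \<in> Q8" "c \<in> omega_powers" "X = ?r (q * c)"
        by (auto simp: carrier_binary_tetrahedral)
      then show "X \<in> ?r ` omega_powers" using absorb by simp
    qed
    show "?r ` omega_powers \<subseteq> rcosets\<^bsub>binary_tetrahedral\<^esub> Q8"
      using sub by (auto simp: RCOSETS_def)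
  qed
  moreover have "inj_on ?r omega_powers"
  proof (rule inj_onI)
    fix c d assume cd: "c \<in> omega_powers" "d \<in> omega_powers" "?r c = ?r d"
    then have "c \<in> ?r d" using T.rcos_self[OF _ Q8.subgroup_axioms, of c] sub by auto
    then obtain q where "q \<in> Q8" "c = q * d" by (auto simp: r_coset_def)
    then show "c = d" using cd(1,2) unfolding omega_powers_def Q8_def
      by (elim insertE emptyE; simp add: quat_arith)
  qed
  moreover have "card omega_powers = 3"
    by (simp add: omega_powers_def quat_arith)
  ultimately show ?thesis by (simp add: card_image)
qed

lemma order_binary_tetrahedral: "order binary_tetrahedral = 24"
proof -
  interpret T: group binary_tetrahedral by (rule group_binary_tetrahedral)
  interpret Q8: normal Q8 binary_tetrahedral by (rule Q8_normal)
  have "card Q8 = 8" by (simp add: Q8_def quat_arith)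
  then show ?thesis
    using T.lagrange[OF Q8.subgroup_axioms] card_rcosets_Q8 by simp
qed

lemma Q8_square: "q \<in> Q8 \<Longrightarrow> q \<noteq> 1 \<Longrightarrow> q \<noteq> - 1 \<Longrightarrow> q * q = - 1"
  unfolding Q8_def by (elim insertE emptyE; simp add: quat_arith)

text \<open>
  The elements outside \<open>Q8\<close> are the 16 quaternions \<open>(\<plusminus>1 \<plusminus> i \<plusminus> j \<plusminus> k) / 2\<close>. With all three imaginary
  coordinates nonzero, such a quaternion commutes with none of \<open>i\<close>, \<open>j\<close>, \<open>k\<close>.
\<close>

lemma Q8_centralizer:
  assumes q: "q \<in> Q8" and a: "a \<in> carrier binary_tetrahedral - Q8" and comm: "q * a = a * q"
  shows "q = 1 \<or> q = - 1"
proof -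
  obtain u c where uc: "a = u * c" "u \<in> Q8" "c \<in> omega_powers"
    using a by (auto simp: carrier_binary_tetrahedral)
  have "c \<noteq> 1" using uc a by auto
  then have "qIm1 a \<noteq> 0 \<and> qIm2 a \<noteq> 0 \<and> qIm3 a \<noteq> 0"
    using uc unfolding omega_powers_def Q8_def
    by (elim insertE emptyE; simp add: quat_arith)
  then show ?thesis
    using q comm unfolding Q8_def
    by (elim insertE emptyE; simp add: quat_arith)
qed

lemma minus_one_central: "- 1 \<in> group_center binary_tetrahedral"
  using normal_imp_subgroup[OF Q8_normal, THEN subgroup.subset]
  by (auto simp: group_center_def Q8_def)

section \<open>The minimal degree\<close>

theorem proposition4p13:
  shows "min_perm_degree (central_square binary_tetrahedral) = 24"
  unfolding min_perm_degree_def
proof (rule Least_equality)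
  interpret T: group binary_tetrahedral by (rule group_binary_tetrahedral)
  have fin: "finite (carrier binary_tetrahedral)"
    using order_binary_tetrahedral T.order_gt_0_iff_finite by simp
  show "mon (central_square binary_tetrahedral) (sym_group 24) \<noteq> {}"
    using T.central_square_embeds[OF fin] unfolding order_binary_tetrahedral .
  fix m assume "mon (central_square binary_tetrahedral) (sym_group m) \<noteq> {}"
  then obtain \<phi> where \<phi>: "\<phi> \<in> mon (central_square binary_tetrahedral) (sym_group m)"
    by blast
  have "- 1 \<noteq> (1 :: quat)" by (simp add: quat_arith)
  moreover have "card K \<le> order binary_tetrahedral"
    if "subgroup K (binary_tetrahedral \<times>\<times> binary_tetrahedral)" "(- 1, 1) \<notin> K" "(1, - 1) \<notin> K"
    for K
    using T.card_subgroup_square_le[OF fin Q8_normal card_rcosets_Q8, of "- 1" K]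
      Q8_square Q8_centralizer that order_binary_tetrahedral by simp
  ultimately show "24 \<le> m"
    using T.central_square_degree_ge[OF fin minus_one_central _ _ \<phi>] order_binary_tetrahedral
    by simp
qed

end
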